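(* For almost all $\theta\in[0,1]$ (with respect to Lebesgue measure), the function $$f(s,\theta)=\prod_{p}\left(1-\frac{e^{2\pi i\theta p}}{p^{s}}\right)^{-1},\qquad \operatorname{Re} s>1,$$ where the product is over all prime numbers $p$, has an analytic continuation in the variable $s$ to the half plane $\operatorname{Re} s>\frac12$, and this continuation does not vanish anywhere in the half plane $\operatorname{Re} s>\frac12$.
   Context: Here $\theta$ is a real number with $0\le\theta\le1$ and $s$ is a complex variable. For $\operatorname{Re} s>1$ the Euler product equals the Dirichlet series $f(s,\theta)=\sum_{n=1}^{\infty}a_n(\theta)n^{-s}$, where $a_n(\theta)=e^{2\pi i(\alpha_1p_1+\dots+\alpha_kp_k)\theta}$ for $n=p_1^{\alpha_1}\cdots p_k^{\alpha_k}$ (prime factorization). *)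

theory Defs
  imports "HOL-Complex_Analysis.Complex_Analysis" "HOL-Computational_Algebra.Primes"
begin

text \<open>
  The product over primes is written as an infinite product over all natural numbers in which
  the composite indices (and \<open>0\<close>, \<open>1\<close>) contribute the factor \<open>1\<close>.
\<close>

definition euler_factor :: "complex \<Rightarrow> real \<Rightarrow> nat \<Rightarrow> complex" where
  "euler_factor s \<theta> p =
     (if prime p
      then inverse (1 - exp (2 * of_real pi * \<i> * of_real \<theta> * of_nat p) / of_nat p powr s)
      else 1)"

definition euler_f :: "complex \<Rightarrow> real \<Rightarrow> complex" where
  "euler_f s \<theta> = (\<Prod>p. euler_factor s \<theta> p)"

text \<open>
  The order of the factors is immaterial: the product converges absolutely for every real
  \<open>\<theta>\<close> when \<open>Re s > 1\<close>. In particular, \<^const>\<open>prodinf\<close> yields its value there.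
\<close>

lemma norm_euler_term:
  assumes "p > 0"
  shows "norm (exp (2 * of_real pi * \<i> * of_real \<theta> * of_nat p) / of_nat p powr s)
         = real p powr (- Re s)"
proof -
  have "norm (exp (2 * of_real pi * \<i> * of_real \<theta> * of_nat p)) = 1"
    by simp
  moreover have "norm (of_nat p powr s) = real p powr Re s"
    using assms by (simp add: norm_powr_real_powr)
  ultimately show ?thesis
    by (simp add: norm_divide powr_minus_divide)
qed

lemma abs_convergent_prod_euler_factor:
  assumes "Re s > 1"
  shows "abs_convergent_prod (euler_factor s \<theta>)"
proof -
  define a where "a = (\<lambda>p. exp (2 * of_real pi * \<i> * of_real \<theta> * of_nat p) / of_nat p powr s)"
  have bound: "norm (euler_factor s \<theta> p - 1) \<le> 2 * real p powr (- Re s)" for p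
  proof (cases "prime p")
    case True
    then have "p \<ge> 2" by (rule prime_ge_2_nat)
    have na: "norm (a p) = real p powr (- Re s)"
      unfolding a_def using \<open>p \<ge> 2\<close> by (intro norm_euler_term) auto
    have "real p powr (- Re s) \<le> real p powr (-1)"
      using \<open>p \<ge> 2\<close> assms by (intro powr_mono) auto
    also have "\<dots> \<le> 1 / 2"
      using \<open>p \<ge> 2\<close> by (simp add: powr_minus field_simps)
    finally have half: "norm (a p) \<le> 1 / 2"
      using na by simp
    have "1 - norm (a p) \<le> norm (1 - a p)"
      using norm_triangle_ineq2[of 1 "a p"] by simp
    with half have ge: "norm (1 - a p) \<ge> 1 / 2" by linarith
    then have nz: "1 - a p \<noteq> 0" by auto
    have "euler_factor s \<theta> p = inverse (1 - a p)"
      using True by (simp add: euler_factor_def a_def)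
    then have "euler_factor s \<theta> p - 1 = a p / (1 - a p)"
      using nz by (simp add: field_simps)
    then have "norm (euler_factor s \<theta> p - 1) = norm (a p) / norm (1 - a p)"
      by (simp add: norm_divide)
    also have "\<dots> \<le> norm (a p) / (1 / 2)"
      using ge by (intro divide_left_mono) (auto intro: mult_pos_pos)
    finally show ?thesis using na by simp
  qed (simp add: euler_factor_def)
  have "summable (\<lambda>p. 2 * real p powr (- Re s))"
    using assms by (intro summable_mult) (simp add: summable_real_powr_iff)
  then have "summable (\<lambda>p. norm (euler_factor s \<theta> p - 1))"
    by (rule summable_comparison_test') (use bound in auto)
  then show ?thesis
    by (simp add: abs_convergent_prod_conv_summable)
qed

lemma euler_factor_has_prod:
  assumes "Re s > 1"
  shows "euler_factor s \<theta> has_prod euler_f s \<theta>"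
  unfolding euler_f_def
  using abs_convergent_prod_euler_factor[OF assms]
  by (intro convergent_prod_has_prod abs_convergent_prod_imp_convergent_prod)

end

theory Submission
  imports Defs
begin

text \<open>
  Taking logarithms in the Euler product splits \<open>log f(s, \<theta>)\<close> into the prime sum
  \<open>G(s) = \<Sum>p. e(\<theta> p) p\<^sup>-\<^sup>s\<close>, where \<open>e(x) = exp (2 \<pi> \<i> x)\<close>, and a remainder \<open>H(s)\<close> whose terms are
  \<open>O(p\<^sup>-\<^sup>2\<^sup>\<sigma>)\<close> with \<open>\<sigma> = Re s\<close>. The remainder is therefore holomorphic for \<open>\<sigma> > 1/2\<close> whatever \<open>\<theta>\<close> is.
  As soon as \<open>G\<close> continues to the same half plane, \<open>exp (G + H)\<close> continues the product and, being
  an exponential, has no zeros (\<open>Euler_product_continuation\<close>).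

  The prime sum is continued by summation by parts. With \<open>S(n) = \<Sum>p\<le>n. e(\<theta> p)\<close> it equals
  \<open>\<Sum>n. S(n) (n\<^sup>-\<^sup>s - (n+1)\<^sup>-\<^sup>s)\<close>, and the differences are of size \<open>\<bar>s\<bar> n\<^sup>-\<^sup>1\<^sup>-\<^sup>\<sigma>\<close>. So it is enough that
  \<open>\<Sum>n. \<bar>S(n)\<bar> n\<^sup>-\<^sup>1\<^sup>-\<^sup>\<sigma>\<close> converges for all \<open>\<sigma> > 1/2\<close>
  (\<open>Abel_summed_Dirichlet_holomorphic\<close>, \<open>Abel_summed_Dirichlet_sums\<close>).

  This holds for almost every \<open>\<theta>\<close> because the \<open>e(\<theta> p)\<close> are orthonormal on \<open>[0, 1]\<close>: the mean square
  of \<open>S(n)\<close> is the number of primes up to \<open>n\<close>, hence at most \<open>n\<close>, and so \<open>S(n)\<close> has size about \<open>\<surd>n\<close> on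
  average. As the series in \<open>\<bar>S(n)\<bar>\<close> has nonnegative terms, these averages and monotone convergence
  already give its convergence almost everywhere (\<open>AE_exponential_sums_summable\<close>).
\<close>

section \<open>Dirichlet series with small partial sums of coefficients\<close>

text \<open>
  The Weierstrass test in the form that Dirichlet series call for: their terms are dominated on the
  regions \<open>Re s \<ge> \<sigma>\<close>, \<open>\<bar>s\<bar> \<le> R\<close>, and every point of the open half plane has a closed disc inside
  such a region.
\<close>
lemma holomorphic_on_half_plane_suminf:
  fixes f :: "nat \<Rightarrow> complex \<Rightarrow> complex"
  assumes hol: "\<And>n. f n holomorphic_on {s. Re s > c}"
    and dom: "\<And>\<sigma> R. \<sigma> > c \<Longrightarrow>
      \<exists>M. summable M \<and> (\<forall>n s. Re s \<ge> \<sigma> \<longrightarrow> norm s \<le> R \<longrightarrow> norm (f n s) \<le> M n)"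
  shows "(\<lambda>s. \<Sum>n. f n s) holomorphic_on {s. Re s > c}"
proof (rule holomorphic_uniform_sequence[where f = "\<lambda>N s. \<Sum>n<N. f n s"])
  show "open {s. Re s > c}"
    by (rule open_halfspace_Re_gt)
  show "(\<lambda>s. \<Sum>n<N. f n s) holomorphic_on {s. Re s > c}" for N
    by (intro holomorphic_on_sum hol)
  fix x assume x: "x \<in> {s. Re s > c}"
  define d where "d = (Re x - c) / 2"
  have d: "d > 0" "c < Re x - d"
    using x by (auto simp: d_def field_simps)
  have near: "Re s \<ge> Re x - d" "norm s \<le> norm x + d" if "s \<in> cball x d" for s
  proof -
    have "norm (x - s) \<le> d"
      using that by (simp add: dist_norm)
    then show "Re s \<ge> Re x - d" "norm s \<le> norm x + d"
      using abs_Re_le_cmod[of "x - s"] norm_triangle_ineq3[of x s] by auto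
  qed
  obtain M where M: "summable M"
      "\<And>n s. Re s \<ge> Re x - d \<Longrightarrow> norm s \<le> norm x + d \<Longrightarrow> norm (f n s) \<le> M n"
    using dom[OF d(2), of "norm x + d"] by blast
  have "uniform_limit (cball x d) (\<lambda>N s. \<Sum>n<N. f n s) (\<lambda>s. \<Sum>n. f n s) sequentially"
    using M near by (intro Weierstrass_m_test[of _ _ M]) auto
  moreover have "cball x d \<subseteq> {s. Re s > c}"
    using near(1) d(2) by fastforce
  ultimately show "\<exists>d>0. cball x d \<subseteq> {s. Re s > c} \<and>
      uniform_limit (cball x d) (\<lambda>N s. \<Sum>n<N. f n s) (\<lambda>s. \<Sum>n. f n s) sequentially"
    using d(1) by blast
qed

text \<open>
  Differencing gains a whole power of \<open>n\<close>, since the derivative of \<open>z\<^sup>-\<^sup>s\<close> is \<open>-s z\<^sup>-\<^sup>s\<^sup>-\<^sup>1\<close>. The condition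
  \<open>Re s \<ge> -1\<close> makes the derivative largest at the left end of the segment from \<open>n\<close> to \<open>n + 1\<close>.
\<close>
lemma norm_powr_minus_diff_le:
  assumes n: "n \<ge> 1" and s: "Re s \<ge> -1"
  shows "norm (of_nat n powr (-s) - of_nat (Suc n) powr (-s))
           \<le> norm s * real n powr (-1 - Re s)"
proof -
  let ?S = "closed_segment (of_nat n) (of_nat (Suc n) :: complex)"
  have seg: "\<exists>x. z = of_real x \<and> x \<ge> real n" if "z \<in> ?S" for z
  proof -
    obtain u where u: "0 \<le> u" "u \<le> 1" "z = (1 - u) *\<^sub>R of_nat n + u *\<^sub>R of_nat (Suc n)"
      using \<open>z \<in> ?S\<close> by (auto simp: in_segment)
    then have "z = of_real (real n + u)"
      by (simp add: scaleR_conv_of_real algebra_simps)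
    with u(1) show ?thesis
      by (intro exI[of _ "real n + u"]) auto
  qed
  have "norm (of_nat n powr (-s) - of_nat (Suc n) powr (-s))
          \<le> norm s * real n powr (-1 - Re s) * norm (of_nat n - of_nat (Suc n) :: complex)"
  proof (rule field_differentiable_bound[where S = ?S and f' = "\<lambda>z. (-s) * z powr (-s - 1)"])
    fix z assume "z \<in> ?S"
    then obtain x where x: "z = of_real x" "x \<ge> real n"
      using seg by blast
    with n have x0: "x > 0" by auto
    then have "z \<notin> \<real>\<^sub>\<le>\<^sub>0"
      using x by (auto simp: complex_nonpos_Reals_iff)
    then show "((\<lambda>z. z powr (-s)) has_field_derivative (-s) * z powr (-s - 1)) (at z within ?S)"
      by (auto intro!: derivative_eq_intros simp: DERIV_subset)
    have "norm (z powr (-s - 1)) = x powr Re (-s - 1)"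
      using x x0 by (simp add: norm_powr_real_powr)
    also have "Re (-s - 1) = -1 - Re s"
      by simp
    also have "x powr (-1 - Re s) \<le> real n powr (-1 - Re s)"
      using x n s by (intro powr_mono2') auto
    finally show "norm ((-s) * z powr (-s - 1)) \<le> norm s * real n powr (-1 - Re s)"
      by (simp add: norm_mult mult_left_mono)
  qed auto
  then show ?thesis
    by (simp add: algebra_simps)
qed

text \<open>
  For \<open>N = 0\<close> both sides vanish, because \<open>0 powr z = 0\<close>.
\<close>
lemma sum_by_parts_Dirichlet:
  fixes a :: "nat \<Rightarrow> complex"
  shows "(\<Sum>n\<le>N. a n * of_nat n powr (-s))
       = (\<Sum>n\<le>N. a n) * of_nat (Suc N) powr (-s)
         + (\<Sum>n\<le>N. (\<Sum>k\<le>n. a k) * (of_nat n powr (-s) - of_nat (Suc n) powr (-s)))"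
  by (induction N) (simp_all add: algebra_simps)

lemma Abel_summed_Dirichlet_term_le:
  fixes a :: "nat \<Rightarrow> complex"
  assumes "a 0 = 0" "Re s \<ge> \<sigma>" "\<sigma> \<ge> -1"
  shows "norm ((\<Sum>k\<le>n. a k) * (of_nat n powr (-s) - of_nat (Suc n) powr (-s)))
           \<le> norm s * (norm (\<Sum>k\<le>n. a k) * real n powr (-1 - \<sigma>))"
proof (cases "n = 0")
  case False
  have "norm (of_nat n powr (-s) - of_nat (Suc n) powr (-s)) \<le> norm s * real n powr (-1 - Re s)"
    using False assms by (intro norm_powr_minus_diff_le) auto
  also have "\<dots> \<le> norm s * real n powr (-1 - \<sigma>)"
    using False assms by (intro mult_left_mono powr_mono) auto
  finally have "norm (\<Sum>k\<le>n. a k) * norm (of_nat n powr (-s) - of_nat (Suc n) powr (-s))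
      \<le> norm (\<Sum>k\<le>n. a k) * (norm s * real n powr (-1 - \<sigma>))"
    by (intro mult_left_mono) auto
  then show ?thesis
    unfolding norm_mult by (simp only: mult.left_commute)
qed (use assms in simp)

text \<open>
  The summed-by-parts series is the continuation: it converges wherever the partial sums of the
  coefficients are small on average, which can be far to the left of where the Dirichlet series
  itself converges absolutely. The condition \<open>a 0 = 0\<close> removes the term with base \<open>0\<close>.
\<close>
lemma Abel_summed_Dirichlet_holomorphic:
  fixes a :: "nat \<Rightarrow> complex"
  assumes a0: "a 0 = 0" and c: "c \<ge> -1"
    and summ: "\<And>\<sigma>. \<sigma> > c \<Longrightarrow> summable (\<lambda>n. norm (\<Sum>k\<le>n. a k) * real n powr (-1 - \<sigma>))"
  shows "(\<lambda>s. \<Sum>n. (\<Sum>k\<le>n. a k) * (of_nat n powr (-s) - of_nat (Suc n) powr (-s)))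
           holomorphic_on {s. Re s > c}"
proof (rule holomorphic_on_half_plane_suminf)
  show "(\<lambda>s. (\<Sum>k\<le>n. a k) * (of_nat n powr (-s) - of_nat (Suc n) powr (-s)))
          holomorphic_on {s. Re s > c}" for n
    using a0 by (cases "n = 0") (auto intro!: holomorphic_intros simp del: of_nat_Suc)
next
  fix \<sigma> R :: real assume \<sigma>: "\<sigma> > c"
  let ?u = "\<lambda>n. norm (\<Sum>k\<le>n. a k) * real n powr (-1 - \<sigma>)"
  have "norm ((\<Sum>k\<le>n. a k) * (of_nat n powr (-s) - of_nat (Suc n) powr (-s))) \<le> R * ?u n"
    if "Re s \<ge> \<sigma>" "norm s \<le> R" for n s
  proof -
    have "norm s * ?u n \<le> R * ?u n"
      using that by (intro mult_right_mono) auto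
    then show ?thesis
      using Abel_summed_Dirichlet_term_le[of a \<sigma> s n] that a0 c \<sigma> by linarith
  qed
  moreover have "summable (\<lambda>n. R * ?u n)"
    by (intro summable_mult summ \<sigma>)
  ultimately show "\<exists>M. summable M \<and> (\<forall>n s. Re s \<ge> \<sigma> \<longrightarrow> norm s \<le> R \<longrightarrow>
      norm ((\<Sum>k\<le>n. a k) * (of_nat n powr (-s) - of_nat (Suc n) powr (-s))) \<le> M n)"
    by blast
qed

text \<open>
  For bounded coefficients the boundary term of the summation by parts is \<open>O(N\<^sup>1\<^sup>-\<^sup>\<sigma>)\<close> and
  disappears when \<open>\<sigma> = Re s > 1\<close>, so there the two series agree.
\<close>
lemma Abel_summed_Dirichlet_sums:
  fixes a :: "nat \<Rightarrow> complex"
  assumes a0: "a 0 = 0" and a1: "\<And>n. norm (a n) \<le> 1" and s: "Re s > 1"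
    and summ: "summable (\<lambda>n. norm (\<Sum>k\<le>n. a k) * real n powr (-1 - Re s))"
  shows "(\<lambda>n. a n * of_nat n powr (-s)) sums
           (\<Sum>n. (\<Sum>k\<le>n. a k) * (of_nat n powr (-s) - of_nat (Suc n) powr (-s)))"
    (is "_ sums (\<Sum>n. ?g n)")
proof -
  have "summable ?g"
    by (rule summable_comparison_test'[OF summable_mult[OF summ, of "norm s"]])
       (rule Abel_summed_Dirichlet_term_le, use a0 s in auto)
  then have g: "(\<lambda>N. \<Sum>n\<le>N. ?g n) \<longlonglongrightarrow> (\<Sum>n. ?g n)"
    using summable_LIMSEQ' by blast
  have boundary: "(\<lambda>N. (\<Sum>n\<le>N. a n) * of_nat (Suc N) powr (-s)) \<longlonglongrightarrow> 0"
  proof (rule Lim_null_comparison)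
    have "norm ((\<Sum>n\<le>N. a n) * of_nat (Suc N) powr (-s)) \<le> real (Suc N) powr (1 - Re s)" for N
    proof -
      have "norm (\<Sum>n\<le>N. a n) \<le> (\<Sum>n\<le>N. norm (a n))"
        by (rule norm_sum)
      also have "\<dots> \<le> (\<Sum>n\<le>N. 1)"
        by (intro sum_mono a1)
      finally have "norm (\<Sum>n\<le>N. a n) \<le> real (Suc N)" by simp
      moreover have "norm (of_nat (Suc N) powr (-s)) = real (Suc N) powr (- Re s)"
        by (subst norm_powr_real_powr) (auto simp del: of_nat_Suc)
      ultimately have "norm ((\<Sum>n\<le>N. a n) * of_nat (Suc N) powr (-s))
          \<le> real (Suc N) * real (Suc N) powr (- Re s)"
        unfolding norm_mult by (simp add: mult_right_mono del: of_nat_Suc)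
      also have "\<dots> = real (Suc N) powr (1 - Re s)"
        by (simp add: powr_diff powr_minus field_simps)
      finally show ?thesis .
    qed
    then show "\<forall>\<^sub>F N in sequentially. norm ((\<Sum>n\<le>N. a n) * of_nat (Suc N) powr (-s))
        \<le> real (Suc N) powr (1 - Re s)"
      by simp
    have "(\<lambda>N. real N powr (1 - Re s)) \<longlonglongrightarrow> 0"
      by (rule tendsto_neg_powr) (use s in \<open>auto simp: filterlim_real_sequentially\<close>)
    then show "(\<lambda>N. real (Suc N) powr (1 - Re s)) \<longlonglongrightarrow> 0"
      by (rule LIMSEQ_Suc)
  qed
  have "(\<lambda>N. \<Sum>n\<le>N. a n * of_nat n powr (-s)) \<longlonglongrightarrow> 0 + (\<Sum>n. ?g n)"
    unfolding sum_by_parts_Dirichlet by (intro tendsto_add boundary g)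
  then show ?thesis
    by (simp add: sums_def_le)
qed

section \<open>Continuation of an Euler product\<close>

lemma norm_Ln_one_minus_plus_le:
  assumes "norm (z :: complex) \<le> 3 / 4"
  shows "norm (- Ln (1 - z) - z) \<le> 4 * norm z ^ 2"
proof -
  have "norm (- Ln (1 - z) - z) = norm (Ln (1 + (- z)) - (- z))"
    using norm_minus_cancel[of "Ln (1 - z) + z"] by (simp del: norm_minus_cancel)
  also have "\<dots> \<le> norm z ^ 2 / (1 - norm z)"
    using Ln_approx_linear[of "- z"] assms by simp
  also have "\<dots> \<le> norm z ^ 2 / (1 / 4)"
    using assms by (intro divide_left_mono) auto
  finally show ?thesis by simp
qed

text \<open>
  With \<open>z\<^sub>n = a n n\<^sup>-\<^sup>s\<close>, the function \<open>F = exp (G + H)\<close> uses the Abel-summed series \<open>G\<close> for the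
  \<open>\<Sum>n. z\<^sub>n\<close> part and \<open>H = \<Sum>n. (- Ln (1 - z\<^sub>n) - z\<^sub>n)\<close> for the quadratic remainder. Vanishing of \<open>a\<close> below \<open>2\<close>
  keeps \<open>\<bar>z\<^sub>n\<bar> \<le> 2\<^sup>-\<^sup>\<sigma>\<close> away from \<open>1\<close> in the half plane, so that \<open>1 - z\<^sub>n\<close> never meets the branch cut
  of \<open>Ln\<close>.
\<close>
lemma Euler_product_continuation:
  fixes a :: "nat \<Rightarrow> complex"
  assumes a_le: "\<And>n. norm (a n) \<le> 1" and a_0: "\<And>n. n < 2 \<Longrightarrow> a n = 0"
    and summ: "\<And>\<sigma>. \<sigma> > 1/2 \<Longrightarrow> summable (\<lambda>n. norm (\<Sum>k\<le>n. a k) * real n powr (-1 - \<sigma>))"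
  obtains F where "F holomorphic_on {s. Re s > 1/2}"
    and "\<And>s. Re s > 1 \<Longrightarrow> (\<lambda>n. inverse (1 - a n * of_nat n powr (-s))) has_prod F s"
    and "\<And>s. F s \<noteq> 0"
proof -
  define z where "z = (\<lambda>n s. a n * of_nat n powr (-s))"
  define G where
    "G = (\<lambda>s. \<Sum>n. (\<Sum>k\<le>n. a k) * (of_nat n powr (-s) - of_nat (Suc n) powr (-s)))"
  define H where "H = (\<lambda>s. \<Sum>n. - Ln (1 - z n s) - z n s)"

  have z_le: "norm (z n s) \<le> real n powr (-\<sigma>)" if "Re s \<ge> \<sigma>" for n s \<sigma>
  proof (cases "n < 2")
    case False
    then have "norm (z n s) = norm (a n) * real n powr (- Re s)"
      by (simp add: z_def norm_mult norm_powr_real_powr)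
    also have "\<dots> \<le> 1 * real n powr (- \<sigma>)"
      using False a_le[of n] that by (intro mult_mono powr_mono) auto
    finally show ?thesis by simp
  qed (simp add: z_def a_0)
  \<comment> \<open>\<open>3/4\<close> is a rational bound for \<open>2\<^sup>-\<^sup>1\<^sup>/\<^sup>2\<close> that is still below \<open>1\<close>.\<close>
  have z_small: "norm (z n s) \<le> 3 / 4" if "Re s \<ge> 1/2" for n s
  proof (cases "n < 2")
    case False
    have "norm (z n s) \<le> real n powr (-(1/2))"
      by (rule z_le) (use that in simp)
    also have "\<dots> \<le> 2 powr (-(1/2))"
      using False by (intro powr_mono2') auto
    also have "\<dots> \<le> 3 / 4"
    proof -
      have "4 / 3 \<le> sqrt 2"
        by (rule real_le_rsqrt) (simp add: power2_eq_square)
      then show ?thesis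
        by (simp add: powr_minus powr_half_sqrt field_simps)
    qed
    finally show ?thesis .
  qed (simp add: z_def a_0)
  have h_le: "norm (- Ln (1 - z n s) - z n s) \<le> 4 * real n powr (- 2 * \<sigma>)"
    if "Re s \<ge> \<sigma>" "\<sigma> \<ge> 1/2" for n s \<sigma>
  proof -
    have "norm (- Ln (1 - z n s) - z n s) \<le> 4 * norm (z n s) ^ 2"
      by (rule norm_Ln_one_minus_plus_le[OF z_small]) (use that in auto)
    also have "\<dots> \<le> 4 * (real n powr (-\<sigma>)) ^ 2"
      by (intro mult_left_mono power_mono z_le that) auto
    also have "(real n powr (-\<sigma>)) ^ 2 = real n powr (- 2 * \<sigma>)"
      by (simp add: power2_eq_square flip: powr_add)
    finally show ?thesis .
  qed
  have h_summ: "summable (\<lambda>n. 4 * real n powr (- 2 * \<sigma>))" if "\<sigma> > 1/2" for \<sigma>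
    using that by (intro summable_mult) (simp add: summable_real_powr_iff)
  have not_slit: "1 - z n s \<notin> \<real>\<^sub>\<le>\<^sub>0" if "Re s \<ge> 1/2" for n s
    using z_small[OF that, of n] abs_Re_le_cmod[of "z n s"]
    by (auto simp: complex_nonpos_Reals_iff)

  have z_hol: "z n holomorphic_on A" for n A
    unfolding z_def using a_0[of n] by (cases "n = 0") (auto intro!: holomorphic_intros)
  have "H holomorphic_on {s. Re s > 1/2}"
    unfolding H_def
  proof (rule holomorphic_on_half_plane_suminf)
    show "(\<lambda>s. - Ln (1 - z n s) - z n s) holomorphic_on {s. Re s > 1/2}" for n
      using not_slit by (intro holomorphic_intros z_hol) auto
    show "\<exists>M. summable M \<and> (\<forall>n s. Re s \<ge> \<sigma> \<longrightarrow> norm s \<le> R \<longrightarrow>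
        norm (- Ln (1 - z n s) - z n s) \<le> M n)" if "\<sigma> > 1/2" for \<sigma> R
      using h_summ[OF that] h_le[of \<sigma>] that by (intro exI[of _ "\<lambda>n. 4 * real n powr (- 2 * \<sigma>)"]) auto
  qed
  moreover have "G holomorphic_on {s. Re s > 1/2}"
    unfolding G_def using summ a_0 by (intro Abel_summed_Dirichlet_holomorphic) auto
  ultimately have hol: "(\<lambda>s. exp (G s + H s)) holomorphic_on {s. Re s > 1/2}"
    by (intro holomorphic_intros)

  have prod: "(\<lambda>n. inverse (1 - a n * of_nat n powr (-s))) has_prod exp (G s + H s)"
    if s: "Re s > 1" for s
  proof -
    have "(\<lambda>n. z n s) sums G s"
      unfolding z_def G_def using a_0 a_le s summ[of "Re s"]
      by (intro Abel_summed_Dirichlet_sums) auto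
    moreover have "(\<lambda>n. - Ln (1 - z n s) - z n s) sums H s"
      unfolding H_def
      by (rule summable_sums, rule summable_comparison_test'[OF h_summ[of "Re s"]])
         (use h_le[of "Re s" s] s in auto)
    ultimately have "(\<lambda>n. z n s + (- Ln (1 - z n s) - z n s)) sums (G s + H s)"
      by (rule sums_add)
    then have "(\<lambda>n. exp (- Ln (1 - z n s))) has_prod exp (G s + H s)"
      by (simp add: has_prod_def sums_imp_has_prod_exp)
    moreover have "exp (- Ln (1 - z n s)) = inverse (1 - a n * of_nat n powr (-s))" for n
    proof -
      have "1 - z n s \<noteq> 0"
        using not_slit[of s n] s by auto
      then show ?thesis
        by (simp add: exp_minus z_def)
    qed
    ultimately show ?thesis by simp
  qed
  show thesis
    by (rule that[OF hol prod]) auto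
qed

section \<open>Exponential sums for almost every frequency\<close>

lemma has_integral_cos_int_period:
  fixes m :: int
  shows "((\<lambda>\<theta>. cos (2 * pi * m * \<theta>)) has_integral (if m = 0 then 1 else 0)) {0..1::real}"
proof (cases "m = 0")
  case True
  then show ?thesis
    using has_integral_const_real[of "1::real" 0 1] by simp
next
  case False
  have "((\<lambda>\<theta>. cos (2 * pi * m * \<theta>)) has_integral
      sin (2 * pi * m * 1) / (2 * pi * m) - sin (2 * pi * m * 0) / (2 * pi * m)) {0..1::real}"
    using False
    by (intro fundamental_theorem_of_calculus)
       (auto intro!: derivative_eq_intros simp flip: has_real_derivative_iff_has_vector_derivative)
  moreover have "sin (2 * pi * m) = 0"
    using sin_int_2pin[of m] by simp
  ultimately show ?thesis
    using False by simp
qed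

text \<open>
  Orthonormality of the characters: in the expanded square the off-diagonal terms are cosines of
  nonzero integer frequency and integrate to \<open>0\<close>.
\<close>
lemma mean_square_exponential_sum:
  assumes "finite A"
  shows "((\<lambda>\<theta>. (norm (\<Sum>k\<in>A. exp (2 * of_real pi * \<i> * of_real \<theta> * of_nat k)))\<^sup>2)
           has_integral real (card A)) {0..1}"
proof -
  have expand: "(norm (\<Sum>k\<in>A. exp (2 * of_real pi * \<i> * of_real \<theta> * of_nat k)))\<^sup>2
      = (\<Sum>j\<in>A. \<Sum>k\<in>A. cos (2 * pi * (int j - int k) * \<theta>))" for \<theta>
  proof -
    have "exp (2 * of_real pi * \<i> * of_real \<theta> * of_nat k) = cis (2 * pi * \<theta> * k)" for k
      by (simp add: cis_conv_exp mult_ac)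
    then have "(norm (\<Sum>k\<in>A. exp (2 * of_real pi * \<i> * of_real \<theta> * of_nat k)))\<^sup>2
        = (\<Sum>k\<in>A. cos (2 * pi * \<theta> * k))\<^sup>2 + (\<Sum>k\<in>A. sin (2 * pi * \<theta> * k))\<^sup>2"
      by (simp add: cmod_power2)
    also have "\<dots> = (\<Sum>j\<in>A. \<Sum>k\<in>A. cos (2 * pi * \<theta> * j - 2 * pi * \<theta> * k))"
      by (simp add: power2_eq_square sum_product cos_diff sum.distrib)
    finally show ?thesis
      by (simp add: algebra_simps)
  qed
  have "((\<lambda>\<theta>. \<Sum>j\<in>A. \<Sum>k\<in>A. cos (2 * pi * (int j - int k) * \<theta>)) has_integral
      (\<Sum>j\<in>A. \<Sum>k\<in>A. if int j - int k = 0 then 1 else 0)) {0..1}"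
    by (intro has_integral_sum assms has_integral_cos_int_period)
  moreover have "(\<Sum>j\<in>A. \<Sum>k\<in>A. if int j - int k = 0 then 1 else 0) = real (card A)"
    using assms by simp
  ultimately show ?thesis
    unfolding expand by simp
qed

text \<open>
  By monotone convergence the sum has a finite integral, hence is finite almost everywhere.
\<close>
lemma AE_summable_of_summable_integrals:
  fixes u :: "nat \<Rightarrow> 'a \<Rightarrow> real"
  assumes int: "\<And>n. integrable M (u n)" and nonneg: "\<And>n x. u n x \<ge> 0"
    and summ: "summable (\<lambda>n. \<integral>x. u n x \<partial>M)"
  shows "AE x in M. summable (\<lambda>n. u n x)"
proof -
  have "(\<integral>\<^sup>+x. (\<Sum>n. ennreal (u n x)) \<partial>M) = (\<Sum>n. \<integral>\<^sup>+x. ennreal (u n x) \<partial>M)"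
    using int by (intro nn_integral_suminf) auto
  also have "\<dots> = (\<Sum>n. ennreal (\<integral>x. u n x \<partial>M))"
    using int nonneg by (subst nn_integral_eq_integral) auto
  also have "\<dots> \<noteq> \<infinity>"
    unfolding infinity_ennreal_def
    by (intro ennreal_suminf_neq_top summ integral_nonneg_AE AE_I2 nonneg)
  finally have "AE x in M. (\<Sum>n. ennreal (u n x)) \<noteq> \<infinity>"
    using int by (intro nn_integral_PInf_AE) auto
  then show ?thesis
    by eventually_elim (use nonneg in \<open>auto intro: summable_suminf_not_top\<close>)
qed

text \<open>
  Let \<open>S(n)\<close> be the norm of the sum over \<open>k \<le> n\<close>. Since \<open>S(n)\<^sup>2\<close> has integral at most \<open>n\<close>, the series
  \<open>\<Sum>n. S(n)\<^sup>2 n\<^sup>-\<^sup>3\<^sup>/\<^sup>2\<^sup>-\<^sup>\<sigma>\<close> converges almost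
  everywhere when \<open>\<sigma> > 1/2\<close>. The weight \<open>-3/2 - \<sigma>\<close> is the one for which the arithmetic-geometric
  mean inequality \<open>S(n) \<surd>n \<le> n + S(n)\<^sup>2\<close> turns this into the first-power statement.
\<close>
lemma AE_exponential_sums_summable:
  fixes P :: "nat set"
  assumes P: "0 \<notin> P"
  shows "AE \<theta> in lebesgue_on {0..1}. \<forall>\<sigma>>1/2.
    summable (\<lambda>n. norm (\<Sum>k\<in>P \<inter> {..n}. exp (2 * of_real pi * \<i> * of_real \<theta> * of_nat k))
                    * real n powr (-1 - \<sigma>))"
proof -
  define S where
    "S = (\<lambda>n \<theta>. norm (\<Sum>k\<in>P \<inter> {..n}. exp (2 * of_real pi * \<i> * of_real \<theta> * of_nat k)))"
  have AE_square: "AE \<theta> in lebesgue_on {0..1}. summable (\<lambda>n. (S n \<theta>)\<^sup>2 * real n powr (-3/2 - \<sigma>))"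
    if \<sigma>: "\<sigma> > 1/2" for \<sigma>
  proof (rule AE_summable_of_summable_integrals)
    show int: "integrable (lebesgue_on {0..1}) (\<lambda>\<theta>. (S n \<theta>)\<^sup>2 * real n powr (-3/2 - \<sigma>))" for n
      unfolding S_def by (intro continuous_imp_integrable_real continuous_intros)
    have eq: "(\<integral>\<theta>. (S n \<theta>)\<^sup>2 * real n powr (-3/2 - \<sigma>) \<partial>lebesgue_on {0..1})
        = real (card (P \<inter> {..n})) * real n powr (-3/2 - \<sigma>)" for n
    proof -
      have "((\<lambda>\<theta>. (S n \<theta>)\<^sup>2 * real n powr (-3/2 - \<sigma>)) has_integral
          real (card (P \<inter> {..n})) * real n powr (-3/2 - \<sigma>)) {0..1}"
        unfolding S_def by (intro has_integral_mult_left mean_square_exponential_sum) auto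
      then show ?thesis
        by (subst lebesgue_integral_eq_integral[OF int]) (simp, rule integral_unique)
    qed
    have card: "real (card (P \<inter> {..n})) \<le> real n" for n
    proof -
      have "P \<inter> {..n} \<subseteq> {1..n}"
        using P by (auto simp: Suc_le_eq intro: gr0I)
      then have "card (P \<inter> {..n}) \<le> card {1..n}"
        by (intro card_mono) auto
      then show ?thesis by simp
    qed
    have "norm (real (card (P \<inter> {..n})) * real n powr (-3/2 - \<sigma>)) \<le> real n powr (-1/2 - \<sigma>)" for n
    proof -
      have "real (card (P \<inter> {..n})) * real n powr (-3/2 - \<sigma>) \<le> real n * real n powr (-3/2 - \<sigma>)"
        by (intro mult_right_mono card) auto
      also have "\<dots> = real n powr (-1/2 - \<sigma>)"
        by (cases "n = 0") (simp_all add: powr_mult_base)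
      finally show ?thesis by simp
    qed
    moreover have "summable (\<lambda>n. real n powr (-1/2 - \<sigma>))"
      using \<sigma> by (simp add: summable_real_powr_iff)
    ultimately show "summable (\<lambda>n. \<integral>\<theta>. (S n \<theta>)\<^sup>2 * real n powr (-3/2 - \<sigma>) \<partial>lebesgue_on {0..1})"
      unfolding eq by (rule summable_comparison_test'[where N = 0, rotated])
  qed auto
  \<comment> \<open>The exceptional set must not depend on \<open>\<sigma>\<close>: countably many exponents tending to \<open>1/2\<close>
    suffice, as the summands decrease in \<open>\<sigma>\<close>.\<close>
  have "AE \<theta> in lebesgue_on {0..1}. \<forall>m::nat.
      summable (\<lambda>n. (S n \<theta>)\<^sup>2 * real n powr (-3/2 - (1/2 + inverse (real (Suc m)))))"
    unfolding AE_all_countable by (intro allI AE_square) simp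
  then show ?thesis
  proof eventually_elim
    case (elim \<theta>)
    show ?case
    proof (intro allI impI)
      fix \<sigma> :: real assume \<sigma>: "\<sigma> > 1/2"
      then obtain m where m: "inverse (real (Suc m)) < \<sigma> - 1/2"
        using reals_Archimedean[of "\<sigma> - 1/2"] by auto
      define \<tau> where "\<tau> = 1/2 + inverse (real (Suc m))"
      have \<tau>: "\<tau> > 1/2" "\<tau> < \<sigma>"
        using m by (auto simp: \<tau>_def)
      have majorant: "S n \<theta> * real n powr (-1 - \<sigma>)
          \<le> real n powr (-1/2 - \<tau>) + (S n \<theta>)\<^sup>2 * real n powr (-3/2 - \<tau>)" for n
      proof (cases "n = 0")
        case False
        have "2 * (S n \<theta> * sqrt n) \<le> real n + (S n \<theta>)\<^sup>2"
          using sum_squares_bound[of "S n \<theta>" "sqrt n"] by simp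
        moreover have "0 \<le> S n \<theta> * sqrt n"
          by (simp add: S_def)
        ultimately have amgm: "S n \<theta> * sqrt n \<le> real n + (S n \<theta>)\<^sup>2"
          by linarith
        have "S n \<theta> * real n powr (-1 - \<sigma>) \<le> S n \<theta> * real n powr (-1 - \<tau>)"
          using False \<tau> by (intro mult_left_mono powr_mono) (auto simp: S_def)
        also have "real n powr (-1 - \<tau>) = sqrt n * real n powr (-3/2 - \<tau>)"
          using False by (simp flip: powr_half_sqrt powr_add)
        also have "S n \<theta> * (sqrt n * real n powr (-3/2 - \<tau>))
            \<le> (real n + (S n \<theta>)\<^sup>2) * real n powr (-3/2 - \<tau>)"
          using amgm by (simp add: mult_right_mono flip: mult.assoc)
        also have "\<dots> = real n powr (-1/2 - \<tau>) + (S n \<theta>)\<^sup>2 * real n powr (-3/2 - \<tau>)"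
          using False by (simp add: distrib_right powr_mult_base)
        finally show ?thesis .
      qed simp
      have "summable (\<lambda>n. real n powr (-1/2 - \<tau>))"
        using \<tau> by (simp add: summable_real_powr_iff)
      moreover have "summable (\<lambda>n. (S n \<theta>)\<^sup>2 * real n powr (-3/2 - \<tau>))"
        unfolding \<tau>_def using elim by blast
      ultimately have "summable (\<lambda>n. S n \<theta> * real n powr (-1 - \<sigma>))"
        by (rule summable_comparison_test'[OF summable_add, where N = 0])
           (use majorant in \<open>auto simp: S_def\<close>)
      then show "summable (\<lambda>n.
          norm (\<Sum>k\<in>P \<inter> {..n}. exp (2 * of_real pi * \<i> * of_real \<theta> * of_nat k))
            * real n powr (-1 - \<sigma>))"
        by (simp add: S_def)
    qed
  qed
qed

section \<open>The Euler product with coefficients \<open>exp (2 \<pi> \<i> \<theta> p)\<close>\<close>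

theorem theorem1:
  shows "AE \<theta> in lebesgue_on {0..1}.
           \<exists>F. F analytic_on {s. Re s > 1 / 2} \<and>
               (\<forall>s. Re s > 1 \<longrightarrow> F s = euler_f s \<theta>) \<and>
               (\<forall>s. Re s > 1 / 2 \<longrightarrow> F s \<noteq> 0)"
proof -
  have "AE \<theta> in lebesgue_on {0..1}. \<forall>\<sigma>>1/2. summable (\<lambda>n.
      norm (\<Sum>k\<in>{p. prime p} \<inter> {..n}. exp (2 * of_real pi * \<i> * of_real \<theta> * of_nat k))
        * real n powr (-1 - \<sigma>))"
    by (rule AE_exponential_sums_summable) auto
  then show ?thesis
  proof eventually_elim
    case (elim \<theta>)
    define a where "a = (\<lambda>n::nat. if prime n
      then exp (2 * of_real pi * \<i> * of_real \<theta> * of_nat n) else (0::complex))"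
    have partial_sum: "(\<Sum>k\<le>n. a k)
        = (\<Sum>k\<in>{p. prime p} \<inter> {..n}. exp (2 * of_real pi * \<i> * of_real \<theta> * of_nat k))" for n
      unfolding a_def by (simp add: sum.If_cases Int_commute)
    have "norm (a n) \<le> 1" for n
      by (simp add: a_def)
    moreover have "a n = 0" if "n < 2" for n
      using that prime_ge_2_nat[of n] by (auto simp: a_def)
    moreover have "summable (\<lambda>n. norm (\<Sum>k\<le>n. a k) * real n powr (-1 - \<sigma>))" if "\<sigma> > 1/2" for \<sigma>
      unfolding partial_sum using elim that by blast
    ultimately obtain F where F: "F holomorphic_on {s. Re s > 1/2}"
        "\<And>s. Re s > 1 \<Longrightarrow> (\<lambda>n. inverse (1 - a n * of_nat n powr (-s))) has_prod F s"
        "\<And>s. F s \<noteq> 0"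
      using Euler_product_continuation[of a] by blast
    have "F s = euler_f s \<theta>" if "Re s > 1" for s
    proof -
      have "(\<lambda>n. inverse (1 - a n * of_nat n powr (-s))) = euler_factor s \<theta>"
        by (auto simp: a_def euler_factor_def powr_minus divide_inverse)
      then show ?thesis
        using F(2)[OF that] euler_factor_has_prod[OF that] by (metis has_prod_unique2)
    qed
    moreover have "F analytic_on {s. Re s > 1/2}"
      using F(1) by (subst analytic_on_open[OF open_halfspace_Re_gt])
    ultimately show ?case
      using F(3) by blast
  qed
qed

end
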